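(* Let $N_t$ be the self-exciting point process with rate function $\lambda$ and initial condition $\gamma\ge 0$, where $x\mapsto\lambda(x)$ is continuous and increasing. For any interval $I=[a,b]$ not containing any fixed point of the equation $x=\lambda(x)$, $$\lim_{t\to\infty}\mathbb{P}\left(\frac{N_t}{t}\in I\right)=0 .$$
   Context: Model: $\lambda:\mathbb{R}_{\ge 0}\to\mathbb{R}_{\ge 0}$ and $\gamma\ge 0$ are given; $N_t$ is a simple point process on $(0,\infty)$ with $N_0=0$ (empty past history) whose intensity at time $t$ with respect to its natural filtration is $\lambda_t=\lambda\left(\frac{N_{t-}+\gamma}{t+1}\right)$; after a possible explosion time $N_t=\infty$. Standing assumptions: $\lambda$ is increasing and continuously differentiable; the equation $x=\lambda(x)$ has finitely many solutions, and each solution $x^*$ satisfies either $\lambda'(x^* )<1$ or $\lambda'(x^* )>1$. *)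

theory Defs
  imports "HOL-Probability.Probability"
begin

text \<open>Paths are functions on \<open>real\<close> of which only the values at times \<open>t \<ge> 0\<close> matter. For the
  nondecreasing paths considered here, the supremum below is the limit from the left.\<close>

definition left_lim :: "(real \<Rightarrow> enat) \<Rightarrow> real \<Rightarrow> enat" where
  "left_lim f t = (SUP s\<in>{0..<t}. f s)"

text \<open>Sample paths of a simple point process on \<open>(0,\<infinity>)\<close>: all jumps have size one, so the value
  \<open>\<infinity>\<close> can only be reached by an accumulation of jumps (explosion), and is then kept forever.\<close>

definition counting_path :: "(real \<Rightarrow> enat) \<Rightarrow> bool" where
  "counting_path f \<longleftrightarrow>
     f 0 = 0 \<and> mono_on {0..} f \<and>
     (\<forall>t\<ge>0. continuous (at_right t) f) \<and>
     (\<forall>t>0. f t \<le> left_lim f t + 1)"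

definition simple_point_process :: "'a measure \<Rightarrow> (real \<Rightarrow> 'a \<Rightarrow> enat) \<Rightarrow> bool" where
  "simple_point_process M N \<longleftrightarrow>
     (\<forall>t\<ge>0. N t \<in> M \<rightarrow>\<^sub>M count_space UNIV) \<and>
     (\<forall>\<omega>\<in>space M. counting_path (\<lambda>t. N t \<omega>))"

definition natural_filtration :: "'a measure \<Rightarrow> (real \<Rightarrow> 'a \<Rightarrow> enat) \<Rightarrow> real \<Rightarrow> 'a measure" where
  "natural_filtration M N t = sigma (space M) {N s -` A \<inter> space M | s A. 0 \<le> s \<and> s \<le> t}"

definition jump_time :: "(real \<Rightarrow> 'a \<Rightarrow> enat) \<Rightarrow> nat \<Rightarrow> 'a \<Rightarrow> ereal" where
  "jump_time N n \<omega> = Inf {ereal t | t. 0 \<le> t \<and> enat n \<le> N t \<omega>}"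

definition stopped :: "(real \<Rightarrow> 'a \<Rightarrow> enat) \<Rightarrow> nat \<Rightarrow> real \<Rightarrow> 'a \<Rightarrow> enat" where
  "stopped N n t \<omega> = N (real_of_ereal (min (ereal t) (jump_time N n \<omega>))) \<omega>"

definition progressive :: "(real \<Rightarrow> 'a measure) \<Rightarrow> (real \<Rightarrow> 'a \<Rightarrow> ennreal) \<Rightarrow> bool" where
  "progressive F X \<longleftrightarrow>
     (\<forall>t\<ge>0. (\<lambda>(u, \<omega>). X u \<omega>) \<in> borel_measurable (restrict_space borel {0..t} \<Otimes>\<^sub>M F t))"

text \<open>The defining property of the intensity \<open>X\<close>, namely
  \<open>E[N\<^sub>t - N\<^sub>s | F\<^sub>s] = E[\<integral>\<^sub>s\<^sup>t X\<^sub>u du | F\<^sub>s]\<close>, is required for the processes stopped at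
  the successive jump times. This allows infinite expectations and explosion; the values of \<open>X\<close>
  after the explosion time are irrelevant.\<close>

definition has_intensity ::
  "'a measure \<Rightarrow> (real \<Rightarrow> 'a measure) \<Rightarrow> (real \<Rightarrow> 'a \<Rightarrow> enat) \<Rightarrow> (real \<Rightarrow> 'a \<Rightarrow> ennreal) \<Rightarrow> bool" where
  "has_intensity M F N X \<longleftrightarrow>
     progressive F X \<and>
     (\<forall>n s t. 0 \<le> s \<and> s \<le> t \<longrightarrow>
        (AE \<omega> in M.
           nn_cond_exp M (F s)
             (\<lambda>\<omega>'. ennreal_of_enat (stopped N n t \<omega>' - stopped N n s \<omega>')) \<omega> =
           nn_cond_exp M (F s)
             (\<lambda>\<omega>'. \<integral>\<^sup>+u. X u \<omega>' * indicator {u. s < u \<and> u \<le> t \<and> ereal u \<le> jump_time N n \<omega>'} u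
                   \<partial>lborel) \<omega>))"

definition self_exciting_intensity ::
  "(real \<Rightarrow> real) \<Rightarrow> real \<Rightarrow> (real \<Rightarrow> 'a \<Rightarrow> enat) \<Rightarrow> real \<Rightarrow> 'a \<Rightarrow> ennreal" where
  "self_exciting_intensity lam \<gamma> N t \<omega> =
     (case left_lim (\<lambda>s. N s \<omega>) t of
        enat k \<Rightarrow> ennreal (lam ((real k + \<gamma>) / (t + 1)))
      | \<infinity> \<Rightarrow> 0)"

definition self_exciting_process ::
  "'a measure \<Rightarrow> (real \<Rightarrow> real) \<Rightarrow> real \<Rightarrow> (real \<Rightarrow> 'a \<Rightarrow> enat) \<Rightarrow> bool" where
  "self_exciting_process M lam \<gamma> N \<longleftrightarrow>
     simple_point_process M N \<and>
     has_intensity M (natural_filtration M N) N (self_exciting_intensity lam \<gamma> N)"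

end

theory Submission
  imports Defs "HOL-Real_Asymp.Real_Asymp"
begin

text \<open>Since the intensity is a function of \<open>N\<^sub>t\<^sub>-\<close> and \<open>t\<close>, subtracting the intensity identities for the
  process stopped at two successive jump times and taking expectations gives the forward equation
  \<open>d/dt P(N\<^sub>t > k) = \<lambda>((k + \<gamma>) / (t + 1)) P(N\<^sub>t = k)\<close>; no further probability is needed. For
  \<open>Y\<^sub>t = (N\<^sub>t + \<gamma>) / (t + 1)\<close> and a smooth \<open>f\<close> vanishing near infinity it yields
  \<open>d/dt E f(Y\<^sub>t) = E[f'(Y\<^sub>t) (\<lambda>(Y\<^sub>t) - Y\<^sub>t)] / (t + 1) + O((t + 1)\<^sup>-\<^sup>2)\<close>. Let \<open>w \<ge> 0\<close> be a bump around the
  interval, supported where \<open>\<lambda>(x) - x\<close> has constant sign and is bounded away from \<open>0\<close>. Taking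
  \<open>f' = w\<close>, boundedness of \<open>f\<close> makes \<open>E w(Y\<^sub>t) / (t + 1)\<close> integrable. As the derivative of \<open>w\<^sup>2\<close> is
  dominated by \<open>w\<close>, \<open>E w(Y\<^sub>t)\<^sup>2\<close> converges, and its limit is \<open>0\<close> because \<open>1 / (t + 1)\<close> is not
  integrable.\<close>

section \<open>Real analysis: convergence from dissipation inequalities\<close>

lemma mono_bounded_tendsto_at_top:
  fixes f :: "real \<Rightarrow> real"
  assumes mono: "\<And>s t. t0 \<le> s \<Longrightarrow> s \<le> t \<Longrightarrow> f s \<le> f t" and bd: "\<And>t. t0 \<le> t \<Longrightarrow> f t \<le> B"
  shows "\<exists>l. (f \<longlongrightarrow> l) at_top"
proof
  have bdd: "bdd_above (f ` {t0..})" using bd by (auto intro!: bdd_aboveI)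
  show "(f \<longlongrightarrow> Sup (f ` {t0..})) at_top"
  proof (rule increasing_tendsto)
    show "\<forall>\<^sub>F t in at_top. f t \<le> Sup (f ` {t0..})"
      using eventually_ge_at_top[of t0] by eventually_elim (auto intro!: cSup_upper bdd)
    fix x assume "x < Sup (f ` {t0..})"
    then obtain s where s: "s \<ge> t0" "x < f s"
      using less_cSup_iff[of "f ` {t0..}" x] bdd by auto
    show "\<forall>\<^sub>F t in at_top. x < f t"
      using eventually_ge_at_top[of s] by eventually_elim (use s mono in \<open>force\<close>)
  qed
qed

text \<open>Up to an integrable error \<open>A\<close> grows at rate at least
  \<open>\<delta> * W t / (t + 1)\<close>, so adding \<open>K / \<delta>\<close> times
  \<open>A\<close> compensates any decrease of \<open>B\<close>. Both corrected functions are
  monotone and bounded, hence \<open>B\<close> converges; a positive limit would make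
  \<open>A\<close> grow logarithmically.\<close>

lemma tendsto_0_of_dissipation:
  fixes A B W :: "real \<Rightarrow> real"
  assumes dA: "\<And>t. t > 0 \<Longrightarrow> (A has_real_derivative A' t) (at t)"
    and dB: "\<And>t. t > 0 \<Longrightarrow> (B has_real_derivative B' t) (at t)"
    and A_bound: "\<And>t. t > 0 \<Longrightarrow> \<bar>A t\<bar> \<le> S"
    and B_nonneg: "\<And>t. t > 0 \<Longrightarrow> 0 \<le> B t"
    and B_bound: "\<And>t. t > 0 \<Longrightarrow> B t \<le> S"
    and B_le: "\<And>t. t > 0 \<Longrightarrow> B t \<le> K * W t"
    and A'_ge: "\<And>t. t > 0 \<Longrightarrow> \<delta> * W t / (t + 1) - C / (t + 1)\<^sup>2 \<le> A' t"
    and B'_ge: "\<And>t. t > 0 \<Longrightarrow> - (K * W t / (t + 1)) - C / (t + 1)\<^sup>2 \<le> B' t"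
    and pos: "\<delta> > 0" "K > 0" "C \<ge> 0"
  shows "(B \<longlongrightarrow> 0) at_top"
proof -
  \<comment> \<open>The term \<open>- C / (t + 1)\<close> has derivative
    \<open>C / (t + 1)\<^sup>2\<close>, which cancels the error.\<close>
  define A1 where "A1 t = A t - C / (t + 1)" for t
  define A1' where "A1' t = A' t + C / (t + 1)\<^sup>2" for t
  define B1 where "B1 t = K / \<delta> * A1 t + B t - C / (t + 1)" for t
  define B1' where "B1' t = K / \<delta> * A1' t + B' t + C / (t + 1)\<^sup>2" for t
  have W_nonneg: "0 \<le> W t" if "t > 0" for t
    using B_nonneg[OF that] B_le[OF that] pos by (metis order_trans zero_le_mult_iff not_le)
  have dA1: "(A1 has_real_derivative A1' t) (at t)" if "t > 0" for t
    unfolding A1_def A1'_def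
    by (rule derivative_eq_intros dA that refl | use that in \<open>simp add: power2_eq_square\<close>)+
  have dB1: "(B1 has_real_derivative B1' t) (at t)" if "t > 0" for t
    unfolding B1_def B1'_def
    by (rule derivative_eq_intros dA1 dB that refl | use that in \<open>simp add: power2_eq_square\<close>)+
  have A1'_ge: "\<delta> * W t / (t + 1) \<le> A1' t" if "t > 0" for t
    using A'_ge[OF that] by (simp add: A1'_def)
  have B1'_nonneg: "0 \<le> B1' t" if "t > 0" for t
  proof -
    have "K * W t / (t + 1) = K / \<delta> * (\<delta> * W t / (t + 1))" using pos by simp
    also have "\<dots> \<le> K / \<delta> * A1' t" using pos by (intro mult_left_mono A1'_ge that) auto
    finally show ?thesis using B'_ge[OF that] by (simp add: B1'_def)
  qed
  have A1'_nonneg: "0 \<le> A1' t" if "t > 0" for t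
  proof -
    have "0 \<le> \<delta> * W t / (t + 1)" using W_nonneg[OF that] pos that by auto
    then show ?thesis using A1'_ge[OF that] by linarith
  qed
  have C_le: "0 \<le> C / (t + 1)" if "t > 0" for t :: real using pos that by simp
  have A1_le: "A1 t \<le> S" if "t > 0" for t
    using A_bound[OF that] C_le[OF that] by (simp add: A1_def)
  have "\<exists>l. (A1 \<longlongrightarrow> l) at_top"
  proof (rule mono_bounded_tendsto_at_top[of 1 _ S])
    show "A1 s \<le> A1 t" if "1 \<le> s" "s \<le> t" for s t
    proof (rule DERIV_nonneg_imp_nondecreasing[OF that(2)])
      fix x assume "s \<le> x" "x \<le> t"
      then have "x > 0" using that by simp
      then show "\<exists>y. (A1 has_real_derivative y) (at x) \<and> 0 \<le> y"
        using dA1 A1'_nonneg by blast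
    qed
  qed (use A1_le in auto)
  then obtain lA where lA: "(A1 \<longlongrightarrow> lA) at_top" by blast
  have "\<exists>l. (B1 \<longlongrightarrow> l) at_top"
  proof (rule mono_bounded_tendsto_at_top[of 1 _ "K / \<delta> * S + S"])
    show "B1 s \<le> B1 t" if "1 \<le> s" "s \<le> t" for s t
    proof (rule DERIV_nonneg_imp_nondecreasing[OF that(2)])
      fix x assume "s \<le> x" "x \<le> t"
      then have "x > 0" using that by simp
      then show "\<exists>y. (B1 has_real_derivative y) (at x) \<and> 0 \<le> y"
        using dB1 B1'_nonneg by blast
    qed
    show "B1 t \<le> K / \<delta> * S + S" if "1 \<le> t" for t
    proof -
      have "K / \<delta> * A1 t \<le> K / \<delta> * S" using A1_le[of t] that pos by (intro mult_left_mono) auto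
      then show ?thesis using B_bound[of t] C_le[of t] that by (simp add: B1_def)
    qed
  qed
  then obtain lB where lB: "(B1 \<longlongrightarrow> lB) at_top" by blast
  have C_lim: "((\<lambda>t. C / (t + 1)) \<longlongrightarrow> 0) at_top"
    by real_asymp
  define l where "l = lB - K / \<delta> * lA + 0"
  have "((\<lambda>t. B1 t - K / \<delta> * A1 t + C / (t + 1)) \<longlongrightarrow> l) at_top"
    unfolding l_def by (intro tendsto_intros lA lB C_lim)
  then have lim: "(B \<longlongrightarrow> l) at_top" by (simp add: B1_def[abs_def])
  have "0 \<le> l"
    by (rule tendsto_lowerbound[OF lim])
      (auto intro!: eventually_mono[OF eventually_gt_at_top[of 0]] B_nonneg)
  moreover have "\<not> 0 < l"
  proof
    assume "0 < l"
    then have "\<forall>\<^sub>F t in at_top. l / 2 < B t" by (intro order_tendstoD(1)[OF lim]) simp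
    then obtain T0 where T0: "\<And>t. t \<ge> T0 \<Longrightarrow> l / 2 < B t"
      by (auto simp: eventually_at_top_linorder)
    define T where "T = max T0 1"
    \<comment> \<open>Once \<open>B\<close> exceeds \<open>l / 2\<close>, \<open>W\<close> is at
      least \<open>l / (2 * K)\<close>, so \<open>A1\<close> has slope at least
      \<open>k / (t + 1)\<close>.\<close>
    define k where "k = \<delta> * (l / 2) / K"
    have k: "k > 0" using pos \<open>0 < l\<close> by (simp add: k_def)
    have step: "A1 T - k * ln (T + 1) \<le> A1 t - k * ln (t + 1)" if "T \<le> t" for t
    proof (rule DERIV_nonneg_imp_nondecreasing[OF that])
      fix x assume x: "T \<le> x" "x \<le> t"
      then have x1: "x > 0" "x \<ge> T0" by (auto simp: T_def)
      have "((\<lambda>t. A1 t - k * ln (t + 1)) has_real_derivative (A1' x - k / (x + 1))) (at x)"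
        by (rule derivative_eq_intros dA1 x1 refl | use x1 in simp)+
      moreover have "k / (x + 1) \<le> A1' x"
      proof -
        have "l / 2 \<le> K * W x" using T0[OF x1(2)] B_le[OF x1(1)] by simp
        then have "k \<le> \<delta> * W x" using pos by (simp add: k_def field_simps)
        then have "k / (x + 1) \<le> \<delta> * W x / (x + 1)" using x1 by (intro divide_right_mono) auto
        then show ?thesis using A1'_ge[OF x1(1)] by linarith
      qed
      ultimately show "\<exists>y. ((\<lambda>t. A1 t - k * ln (t + 1)) has_real_derivative y) (at x) \<and> 0 \<le> y"
        by (intro exI conjI) auto
    qed
    have "filterlim (\<lambda>t. k * ln (t + 1)) at_top at_top"
      using k by real_asymp
    then have "\<forall>\<^sub>F t in at_top. S - A1 T + k * ln (T + 1) < k * ln (t + 1)"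
      by (simp add: filterlim_at_top_dense)
    then have "\<forall>\<^sub>F t :: real in at_top. False"
      using eventually_ge_at_top[of T]
    proof eventually_elim
      case (elim t)
      then show ?case using step[of t] A1_le[of t] by (simp add: T_def)
    qed
    then show False by simp
  qed
  ultimately show ?thesis using lim by simp
qed

section \<open>Calculus for test functions with Lipschitz derivative\<close>

text \<open>The mean value theorem stands in for a second-order expansion: the piecewise polynomial
  test functions used later have no second derivative at the ends of the bump.\<close>

lemma taylor_lipschitz_deriv:
  fixes f f' :: "real \<Rightarrow> real"
  assumes deriv: "\<And>x. (f has_real_derivative f' x) (at x)"
    and lip: "\<And>x y. \<bar>f' x - f' y\<bar> \<le> L * \<bar>x - y\<bar>" and h: "h > 0"
  shows "\<bar>f (x + h) - f x - f' x * h\<bar> \<le> L * h\<^sup>2"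
proof -
  obtain z where z: "x < z" "z < x + h" "f (x + h) - f x = (x + h - x) * f' z"
    using MVT2[of x "x + h" f f'] h deriv by auto
  have L: "L \<ge> 0" using lip[of 0 1] by (auto intro: order_trans[OF abs_ge_zero])
  have "f (x + h) - f x - f' x * h = h * (f' z - f' x)" using z by (simp add: algebra_simps)
  then have "\<bar>f (x + h) - f x - f' x * h\<bar> = h * \<bar>f' z - f' x\<bar>" using h by (simp add: abs_mult)
  also have "\<dots> \<le> h * (L * \<bar>z - x\<bar>)" using h by (intro mult_left_mono lip) auto
  also have "\<dots> \<le> h * (L * h)" using h L z by (intro mult_left_mono) auto
  finally show ?thesis by (simp add: power2_eq_square mult_ac)
qed

text \<open>The clamp has kinks at \<open>c\<close> and \<open>d\<close>, but \<open>g\<close>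
  vanishes at the values taken there, so the chain rule formula survives.\<close>

lemma has_real_derivative_clamp:
  fixes G g :: "real \<Rightarrow> real"
  assumes G: "\<And>r. (G has_real_derivative g r) (at r)" and g: "g 0 = 0" "g D = 0"
    and D: "D = d - c" "c < d"
  shows "((\<lambda>x. G (max 0 (min D (x - c)))) has_real_derivative g (max 0 (min D (x - c)))) (at x)"
proof (cases "c < x \<and> x < d")
  case True
  have "((\<lambda>x. G (x - c)) has_real_derivative g (x - c) * (1 - 0)) (at x)"
    by (intro DERIV_chain2[OF G] DERIV_diff DERIV_ident DERIV_const)
  then have "((\<lambda>x. G (x - c)) has_real_derivative g (max 0 (min D (x - c)))) (at x)"
    using True D by simp
  then show ?thesis
    by (rule has_field_derivative_transform_within_open[of _ _ _ "{c<..<d}"]) (use True D in auto)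
next
  case False
  define s where "s y = max 0 (min D (y - c))" for y
  have s_lip: "\<bar>s y - s x\<bar> \<le> \<bar>y - x\<bar>" for y unfolding s_def by auto
  have "s x = 0 \<or> s x = D" using False D by (auto simp: s_def)
  then have gs: "g (s x) = 0" using g by auto
  \<comment> \<open>A vanishing derivative of \<open>G\<close> at \<open>s x\<close> is preserved by
    composition with the 1-Lipschitz map \<open>s\<close>, differentiable or not.\<close>
  have "((\<lambda>y. G (s y)) has_derivative (\<lambda>h. 0)) (at x)"
    unfolding has_derivative_at_alt
  proof (intro conjI allI impI)
    fix e :: real assume "e > 0"
    have "(G has_derivative (\<lambda>h. 0)) (at (s x))"
      using G[of "s x"] unfolding gs has_field_derivative_def by (simp add: lambda_zero)
    then obtain r where r: "r > 0" "\<And>y. norm (y - s x) < r \<Longrightarrow> norm (G y - G (s x)) \<le> e * norm (y - s x)"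
      using \<open>e > 0\<close> unfolding has_derivative_at_alt by force
    have "norm (G (s y) - G (s x) - 0) \<le> e * norm (y - x)" if "norm (y - x) < r" for y
    proof -
      have "norm (G (s y) - G (s x)) \<le> e * norm (s y - s x)"
        using r(2)[of "s y"] s_lip[of y] that by simp
      also have "\<dots> \<le> e * norm (y - x)" using s_lip[of y] \<open>e > 0\<close> by simp
      finally show ?thesis by simp
    qed
    then show "\<exists>r>0. \<forall>y. norm (y - x) < r \<longrightarrow> norm (G (s y) - G (s x) - 0) \<le> e * norm (y - x)"
      using r(1) by blast
  qed simp
  then show ?thesis
    using gs unfolding has_field_derivative_def by (simp add: s_def lambda_zero)
qed

section \<open>The forward equation and the generator of the rescaled process\<close>

text \<open>Separates the analysis from the probability space: \<open>q n t\<close> plays the role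
  of the probability of at least \<open>n\<close> jumps up to time \<open>t\<close>.\<close>

locale forward_equation =
  fixes lam :: "real \<Rightarrow> real" and \<gamma> :: real and q :: "nat \<Rightarrow> real \<Rightarrow> real"
  assumes gamma_nonneg: "\<gamma> \<ge> 0"
    and lam_nonneg: "x \<ge> 0 \<Longrightarrow> lam x \<ge> 0"
    and lam_mono: "mono_on {0..} lam"
    and q_0: "t > 0 \<Longrightarrow> q 0 t = 1"
    and q_Suc_le: "t > 0 \<Longrightarrow> q (Suc n) t \<le> q n t"
    and q_nonneg: "t > 0 \<Longrightarrow> q n t \<ge> 0"
    and q_deriv: "t > 0 \<Longrightarrow> (q (Suc n) has_real_derivative
      lam ((real n + \<gamma>) / (t + 1)) * (q n t - q (Suc n) t)) (at t)"
begin

definition level :: "nat \<Rightarrow> real \<Rightarrow> real" where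
  "level n t = (real n + \<gamma>) / (t + 1)"

definition p :: "nat \<Rightarrow> real \<Rightarrow> real" where
  "p n t = q n t - q (Suc n) t"

text \<open>The expectation of \<open>g\<close> at the rescaled process on the event of no
  explosion; the masses \<open>p n t\<close> may sum to less than 1. It is used for \<open>g\<close>
  vanishing from some \<open>d\<close> on, where the series is a finite sum.\<close>

definition mean :: "(real \<Rightarrow> real) \<Rightarrow> real \<Rightarrow> real" where
  "mean g t = (\<Sum>n. g (level n t) * p n t)"

lemma level_nonneg: "t > 0 \<Longrightarrow> 0 \<le> level n t"
  using gamma_nonneg by (simp add: level_def)

lemma level_Suc: "t > 0 \<Longrightarrow> level (Suc n) t = level n t + 1 / (t + 1)"
  by (simp add: level_def add_divide_distrib)

lemma level_ge:
  assumes "t > 0" "d * (t + 1) \<le> real K" "K \<le> n" shows "d \<le> level n t"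
proof -
  have "d * (t + 1) \<le> real n + \<gamma>" using assms gamma_nonneg by (smt (verit) of_nat_mono)
  then show ?thesis using assms by (simp add: level_def field_simps)
qed

lemma p_nonneg: "t > 0 \<Longrightarrow> 0 \<le> p n t"
  using q_Suc_le by (simp add: p_def)

lemma sum_p_le_1: "t > 0 \<Longrightarrow> (\<Sum>n<K. p n t) \<le> 1"
  using q_0[of t] q_nonneg[of t K] sum_lessThan_telescope'[of "\<lambda>n. q n t" K] by (simp add: p_def)

lemma mean_eq_sum:
  assumes "\<And>x. x \<ge> d \<Longrightarrow> g x = 0" "t > 0" "d * (t + 1) \<le> real K"
  shows "mean g t = (\<Sum>n<K. g (level n t) * p n t)"
  unfolding mean_def
  by (rule suminf_finite) (use assms level_ge[OF assms(2,3)] in \<open>auto simp: not_less\<close>)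

lemma mean_mono:
  assumes "\<And>x. x \<ge> d \<Longrightarrow> g x = 0" "\<And>x. x \<ge> d \<Longrightarrow> h x = 0" "t > 0"
    and "\<And>x. x \<ge> 0 \<Longrightarrow> g x \<le> h x"
  shows "mean g t \<le> mean h t"
proof -
  obtain K where K: "d * (t + 1) \<le> real K" using real_arch_simple by blast
  have "mean g t = (\<Sum>n<K. g (level n t) * p n t)" "mean h t = (\<Sum>n<K. h (level n t) * p n t)"
    using assms K by (blast intro: mean_eq_sum)+
  then show ?thesis
    by (simp only:) (intro sum_mono mult_right_mono p_nonneg assms level_nonneg)
qed

lemma mean_cmult:
  assumes "\<And>x. x \<ge> d \<Longrightarrow> g x = 0" "t > 0"
  shows "mean (\<lambda>x. k * g x) t = k * mean g t"
proof -
  obtain K where K: "d * (t + 1) \<le> real K" using real_arch_simple by blast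
  show ?thesis
    by (subst (1 2) mean_eq_sum[of d _, OF _ assms(2) K])
      (auto simp: assms sum_distrib_left mult_ac)
qed

lemma abs_mean_le:
  assumes "\<And>x. x \<ge> d \<Longrightarrow> g x = 0" "t > 0"
    and "\<And>x. x \<ge> 0 \<Longrightarrow> \<bar>g x\<bar> \<le> B"
  shows "\<bar>mean g t\<bar> \<le> B"
proof -
  obtain K where K: "d * (t + 1) \<le> real K" using real_arch_simple by blast
  have B: "B \<ge> 0" using assms(3)[of 0] by simp
  have "\<bar>mean g t\<bar> \<le> (\<Sum>n<K. \<bar>g (level n t) * p n t\<bar>)"
    by (subst mean_eq_sum[of d g]) (use assms K in \<open>auto intro: sum_abs\<close>)
  also have "\<dots> \<le> (\<Sum>n<K. B * p n t)"
    using assms level_nonneg p_nonneg by (intro sum_mono) (auto simp: abs_mult intro!: mult_right_mono)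
  also have "\<dots> = B * (\<Sum>n<K. p n t)" by (simp add: sum_distrib_left)
  also have "\<dots> \<le> B * 1" using B sum_p_le_1 assms by (intro mult_left_mono) auto
  finally show ?thesis by simp
qed

text \<open>The flux of probability from count \<open>n\<close> to \<open>n + 1\<close>;
  \<open>p_deriv\<close> is then a balance of inflow and outflow.\<close>

definition p_flow :: "nat \<Rightarrow> real \<Rightarrow> real" where
  "p_flow n t = lam (level n t) * p n t"

lemma p_deriv:
  assumes "t > 0"
  shows "(p n has_real_derivative (if n = 0 then 0 else p_flow (n - 1) t) - p_flow n t) (at t)"
proof (cases n)
  case 0
  have "(q 0 has_real_derivative 0) (at t)"
    by (rule DERIV_cong[OF has_field_derivative_transform_within_open[of "\<lambda>_. 1" _ _ "{0<..}"]])
      (use assms q_0 in auto)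
  with 0 show ?thesis
    using q_deriv[OF assms, of 0] unfolding p_def[abs_def] p_flow_def p_def level_def
    by (auto intro!: derivative_eq_intros)
next
  case (Suc m)
  then show ?thesis
    using q_deriv[OF assms, of m] q_deriv[OF assms, of "Suc m"]
    unfolding p_def[abs_def] p_flow_def p_def level_def
    by (auto intro!: derivative_eq_intros)
qed

lemma level_deriv:
  assumes "t > 0"
  shows "(level n has_real_derivative - (level n t / (t + 1))) (at t)"
proof -
  have "((\<lambda>t. (real n + \<gamma>) / (t + 1)) has_real_derivative
      (0 * (t + 1) - (real n + \<gamma>) * (1 + 0)) / ((t + 1) * (t + 1))) (at t)"
    using assms by (intro DERIV_divide DERIV_add DERIV_const DERIV_ident) simp
  moreover have "(0 * (t + 1) - (real n + \<gamma>) * (1 + 0)) / ((t + 1) * (t + 1)) =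
      - (level n t / (t + 1))"
    by (simp add: level_def minus_divide_left)
  ultimately show ?thesis by (simp add: level_def[abs_def])
qed

text \<open>The finite sum is differentiated termwise and the index shift is moved from the inflow
  onto \<open>f\<close>. Choosing \<open>K\<close> for \<open>t + 2\<close> instead of
  \<open>t + 1\<close> gives one summation range for all times up to \<open>t + 1\<close>, hence for
  a neighbourhood of \<open>t\<close>.\<close>

lemma mean_deriv:
  assumes deriv: "\<And>x. (f has_real_derivative f' x) (at x)"
    and zero: "\<And>x. x \<ge> d \<Longrightarrow> f x = 0" and t: "t > 0" and K: "d * (t + 2) \<le> real K" and "d \<ge> 0"
  shows "(mean f has_real_derivative (\<Sum>n<K. p n t *
     (lam (level n t) * (f (level (Suc n) t) - f (level n t)) - f' (level n t) * (level n t / (t + 1)))))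
     (at t)"
proof -
  have K': "d * (s + 1) \<le> real K" if "s \<le> t + 1" for s
    using mult_left_mono[of "s + 1" "t + 2" d] that K \<open>d \<ge> 0\<close> by linarith
  \<comment> \<open>Removes the boundary term produced by the index shift.\<close>
  have fK: "f (level K t) = 0" using level_ge[OF t K'[of t]] zero by auto
  have "((\<lambda>s. \<Sum>n<K. f (level n s) * p n s) has_real_derivative
      (\<Sum>n<K. f' (level n t) * - (level n t / (t + 1)) * p n t +
         ((if n = 0 then 0 else p_flow (n - 1) t) - p_flow n t) * f (level n t))) (at t)"
    by (intro DERIV_sum DERIV_mult p_deriv t DERIV_chain2[OF deriv] level_deriv)
  moreover have "(\<Sum>n<K. (if n = 0 then 0 else p_flow (n - 1) t) * f (level n t)) =
      (\<Sum>n<K. p_flow n t * f (level (Suc n) t))"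
  proof (cases K)
    case (Suc K')
    then have "(\<Sum>n<K. (if n = 0 then 0 else p_flow (n - 1) t) * f (level n t)) =
       (\<Sum>n<K'. p_flow n t * f (level (Suc n) t))"
      by (simp add: sum.lessThan_Suc_shift del: sum.lessThan_Suc)
    also have "\<dots> = (\<Sum>n<K. p_flow n t * f (level (Suc n) t))" using Suc fK by simp
    finally show ?thesis .
  qed simp
  ultimately have "((\<lambda>s. \<Sum>n<K. f (level n s) * p n s) has_real_derivative
     (\<Sum>n<K. p n t *
     (lam (level n t) * (f (level (Suc n) t) - f (level n t)) - f' (level n t) * (level n t / (t + 1)))))
     (at t)"
    by (simp add: p_flow_def algebra_simps sum.distrib sum_subtractf)
  then show ?thesis
  proof (rule has_field_derivative_transform_within_open[of _ _ _ "{0<..<t + 1}"])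
    show "(\<Sum>n<K. f (level n s) * p n s) = mean f s" if "s \<in> {0<..<t + 1}" for s
      using mean_eq_sum[of d f s K] zero K'[of s] that by simp
  qed (use t in auto)
qed

text \<open>To first order in the jump height \<open>1 / (t + 1)\<close> the jumps contribute
  \<open>f' x * lam x / (t + 1)\<close>, and the growing denominator contributes
  \<open>- f' x * x / (t + 1)\<close>. The remainder is quadratic in the height, times a rate at
  most \<open>lam d\<close> below \<open>d\<close>; from \<open>d\<close> on it vanishes.\<close>

lemma mean_generator:
  assumes deriv: "\<And>x. (f has_real_derivative f' x) (at x)"
    and zero: "\<And>x. x \<ge> d \<Longrightarrow> f x = 0" "\<And>x. x \<ge> d \<Longrightarrow> f' x = 0"
    and lip: "\<And>x y. \<bar>f' x - f' y\<bar> \<le> L * \<bar>x - y\<bar>"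
    and t: "t > 0" and "d \<ge> 0"
  shows "\<exists>D. (mean f has_real_derivative D) (at t) \<and>
    \<bar>D - mean (\<lambda>x. f' x * (lam x - x)) t / (t + 1)\<bar> \<le> L * lam d / (t + 1)\<^sup>2"
proof -
  obtain K where K: "d * (t + 2) \<le> real K" using real_arch_simple by blast
  have K1: "d * (t + 1) \<le> real K"
    using mult_left_mono[of "t + 1" "t + 2" d] K \<open>d \<ge> 0\<close> by linarith
  have L: "L \<ge> 0" using lip[of 0 1] by (auto intro: order_trans[OF abs_ge_zero])
  have B: "0 \<le> L * lam d / (t + 1)\<^sup>2" using L lam_nonneg \<open>d \<ge> 0\<close> by simp
  let ?D = "\<Sum>n<K. p n t * (lam (level n t) * (f (level (Suc n) t) - f (level n t)) -
      f' (level n t) * (level n t / (t + 1)))"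
  have err: "\<bar>lam y * (f (y + 1 / (t + 1)) - f y - f' y * (1 / (t + 1)))\<bar> \<le> L * lam d / (t + 1)\<^sup>2"
    if "y \<ge> 0" for y
  proof (cases "y \<ge> d")
    case True
    moreover have "y + 1 / (t + 1) \<ge> d" using True t by (simp add: add_increasing2)
    ultimately show ?thesis using B by (simp add: zero)
  next
    case False
    have "lam y \<le> lam d" using False that \<open>d \<ge> 0\<close> by (intro mono_onD[OF lam_mono]) auto
    then have "\<bar>lam y * (f (y + 1 / (t + 1)) - f y - f' y * (1 / (t + 1)))\<bar> \<le>
        lam d * (L * (1 / (t + 1))\<^sup>2)"
      unfolding abs_mult using lam_nonneg[OF that] t
      by (intro mult_mono taylor_lipschitz_deriv[OF deriv lip]) auto
    then show ?thesis by (simp add: power_divide mult_ac)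
  qed
  define e where "e n = f (level n t + 1 / (t + 1)) - f (level n t) - f' (level n t) * (1 / (t + 1))" for n
  have "?D - mean (\<lambda>x. f' x * (lam x - x)) t / (t + 1) = (\<Sum>n<K. p n t * (lam (level n t) * e n))"
    by (subst mean_eq_sum[of d _, OF _ t K1])
      (auto simp: e_def zero level_Suc t sum_divide_distrib sum_subtractf[symmetric] algebra_simps
        add_divide_distrib diff_divide_distrib intro!: sum.cong)
  also have "\<bar>\<dots>\<bar> \<le> (\<Sum>n<K. \<bar>p n t * (lam (level n t) * e n)\<bar>)"
    by (rule sum_abs)
  also have "\<dots> = (\<Sum>n<K. p n t * \<bar>lam (level n t) * e n\<bar>)"
    using p_nonneg[OF t] by (simp add: abs_mult)
  also have "\<dots> \<le> (\<Sum>n<K. p n t * (L * lam d / (t + 1)\<^sup>2))"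
    unfolding e_def by (intro sum_mono mult_left_mono err[OF level_nonneg[OF t]] p_nonneg[OF t])
  also have "\<dots> = (\<Sum>n<K. p n t) * (L * lam d / (t + 1)\<^sup>2)" by (simp only: sum_distrib_right)
  also have "\<dots> \<le> 1 * (L * lam d / (t + 1)\<^sup>2)"
    by (intro mult_right_mono sum_p_le_1 t B)
  finally show ?thesis
    using mean_deriv[OF deriv zero(1) t K \<open>d \<ge> 0\<close>] by (intro exI conjI) auto
qed

text \<open>Instance of the dissipation lemma with the means of \<open>\<Phi>\<close>,
  \<open>\<psi>\<close> and \<open>w\<close> for \<open>A\<close>, \<open>B\<close> and
  \<open>W\<close>; the factor \<open>\<sigma>\<close> orients \<open>\<Phi>\<close> along the
  drift. The bound \<open>c\<close> may be negative, hence the drift condition only for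
  \<open>0 \<le> x\<close>.\<close>

lemma mean_tendsto_0:
  assumes "0 \<le> d" "c < d" and \<sigma>: "\<sigma> = 1 \<or> \<sigma> = - 1" and \<delta>: "\<delta> > 0"
    and drift: "\<And>x. 0 \<le> x \<Longrightarrow> c \<le> x \<Longrightarrow> x \<le> d \<Longrightarrow> \<delta> \<le> \<sigma> * (lam x - x)"
  shows "(mean (\<lambda>x. (max 0 (x - c) * max 0 (d - x))\<^sup>2) \<longlongrightarrow> 0) at_top"
proof -
  define D where "D = d - c"
  define s where "s x = max 0 (min D (x - c))" for x :: real
  define w where "w x = s x * (D - s x)" for x
  \<comment> \<open>The antiderivative of \<open>w\<close> whose constant makes it vanish from
    \<open>d\<close> on, as a finite mean requires.\<close>
  define \<Phi> where "\<Phi> x = D * (s x)\<^sup>2 / 2 - s x ^ 3 / 3 - D ^ 3 / 6" for x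
  \<comment> \<open>Squaring gives the derivative a factor \<open>w\<close>; the slope of
    \<open>w\<close> itself does not tend to 0 at the ends of the bump and could not be dominated by
    \<open>w\<close>.\<close>
  define \<psi> where "\<psi> x = (w x)\<^sup>2" for x
  define \<psi>' where "\<psi>' x = 2 * w x * (D - 2 * s x)" for x
  define S where "S = D ^ 3 + D ^ 4"
  \<comment> \<open>The coefficients \<open>D\<close> and \<open>6 * D\<^sup>2\<close> are the
    Lipschitz constants of \<open>w\<close> and \<open>\<psi>'\<close>.\<close>
  define C where "C = (D + 6 * D\<^sup>2) * lam d"
  \<comment> \<open>The first summand gives \<open>\<psi> x \<le> K * w x\<close>, the second bounds
    the drift of \<open>\<psi>\<close> by \<open>K * w x\<close>.\<close>
  define K where "K = D\<^sup>2 + 2 * D * (lam d + d)"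
  have D: "D > 0" using assms by (simp add: D_def)
  have lam_d: "lam d \<ge> 0" using lam_nonneg \<open>0 \<le> d\<close> by simp
  have s: "0 \<le> s x" "s x \<le> D" for x using D by (auto simp: s_def)
  have s_lip: "\<bar>s x - s y\<bar> \<le> \<bar>x - y\<bar>" for x y unfolding s_def by auto
  have s_d: "s x = D" if "x \<ge> d" for x using that D by (auto simp: s_def D_def)
  have s_c: "s x = 0" if "x \<le> c" for x using that D by (auto simp: s_def)
  have zero: "w x = 0" "\<Phi> x = 0" "\<psi> x = 0" "\<psi>' x = 0" if "x \<ge> d" for x
    using s_d[OF that] by (auto simp: w_def \<Phi>_def \<psi>_def \<psi>'_def power2_eq_square power3_eq_cube)
  have w_nonneg: "0 \<le> w x" for x using s[of x] by (simp add: w_def)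
  have w_le: "w x \<le> D\<^sup>2" for x
    using s[of x] D unfolding w_def power2_eq_square by (intro mult_mono) auto
  have d\<Phi>: "(\<Phi> has_real_derivative w x) (at x)" for x
    unfolding \<Phi>_def[abs_def] w_def s_def
    by (rule has_real_derivative_clamp[OF _ _ _ D_def \<open>c < d\<close>])
      (auto intro!: derivative_eq_intros simp: algebra_simps power2_eq_square)
  have d\<psi>: "(\<psi> has_real_derivative \<psi>' x) (at x)" for x
    unfolding \<psi>_def[abs_def] \<psi>'_def w_def s_def
    by (rule has_real_derivative_clamp[OF _ _ _ D_def \<open>c < d\<close>])
      (auto intro!: derivative_eq_intros simp: algebra_simps power2_eq_square)
  have w_lip_s: "\<bar>w x - w y\<bar> \<le> D * \<bar>s x - s y\<bar>" for x y
  proof -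
    have "w x - w y = (D - s x - s y) * (s x - s y)" by (simp add: w_def algebra_simps)
    moreover have "\<bar>D - s x - s y\<bar> \<le> D" using s[of x] s[of y] by auto
    ultimately show ?thesis by (simp add: abs_mult mult_right_mono)
  qed
  have w_lip: "\<bar>w x - w y\<bar> \<le> D * \<bar>x - y\<bar>" for x y
    by (rule order_trans[OF w_lip_s mult_left_mono[OF s_lip]]) (use D in simp)
  have D2s: "\<bar>D - 2 * s x\<bar> \<le> D" for x using s[of x] by auto
  have \<psi>'_lip: "\<bar>\<psi>' x - \<psi>' y\<bar> \<le> 6 * D\<^sup>2 * \<bar>x - y\<bar>" for x y
  proof -
    \<comment> \<open>Discrete product rule; its two parts contribute \<open>2 * D\<^sup>2\<close>
      and \<open>4 * D\<^sup>2\<close>.\<close>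
    have "\<psi>' x - \<psi>' y = 2 * ((w x - w y) * (D - 2 * s x)) - 4 * (w y * (s x - s y))"
      by (simp add: \<psi>'_def algebra_simps)
    also have "\<bar>\<dots>\<bar> \<le> 2 * (\<bar>w x - w y\<bar> * \<bar>D - 2 * s x\<bar>) + 4 * (w y * \<bar>s x - s y\<bar>)"
      using w_nonneg[of y] by (intro order_trans[OF abs_triangle_ineq4]) (simp add: abs_mult)
    also have "\<dots> \<le> 2 * ((D * \<bar>x - y\<bar>) * D) + 4 * (D\<^sup>2 * \<bar>x - y\<bar>)"
      using D by (intro add_mono mult_left_mono mult_mono w_lip D2s w_le s_lip) auto
    finally show ?thesis by (simp add: power2_eq_square algebra_simps)
  qed
  have "\<forall>t\<in>{0<..}. \<exists>y. (mean \<Phi> has_real_derivative y) (at t) \<and>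
    \<bar>y - mean (\<lambda>x. w x * (lam x - x)) t / (t + 1)\<bar> \<le> D * lam d / (t + 1)\<^sup>2"
    by (intro ballI mean_generator[where d = d and f' = "w"] d\<Phi> zero w_lip \<open>0 \<le> d\<close>) simp_all
  from bchoice[OF this] obtain \<Phi>1 where "\<forall>t\<in>{0<..}. (mean \<Phi> has_real_derivative \<Phi>1 t) (at t) \<and>
    \<bar>\<Phi>1 t - mean (\<lambda>x. w x * (lam x - x)) t / (t + 1)\<bar> \<le> D * lam d / (t + 1)\<^sup>2" ..
  then have \<Phi>1: "\<And>t. t > 0 \<Longrightarrow> (mean \<Phi> has_real_derivative \<Phi>1 t) (at t)"
    "\<And>t. t > 0 \<Longrightarrow> \<bar>\<Phi>1 t - mean (\<lambda>x. w x * (lam x - x)) t / (t + 1)\<bar> \<le> D * lam d / (t + 1)\<^sup>2"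
    by simp_all
  have "\<forall>t\<in>{0<..}. \<exists>y. (mean \<psi> has_real_derivative y) (at t) \<and>
    \<bar>y - mean (\<lambda>x. \<psi>' x * (lam x - x)) t / (t + 1)\<bar> \<le> 6 * D\<^sup>2 * lam d / (t + 1)\<^sup>2"
    by (intro ballI mean_generator[where d = d and f' = "\<psi>'"] d\<psi> zero \<psi>'_lip \<open>0 \<le> d\<close>) simp_all
  from bchoice[OF this] obtain \<psi>1 where "\<forall>t\<in>{0<..}. (mean \<psi> has_real_derivative \<psi>1 t) (at t) \<and>
    \<bar>\<psi>1 t - mean (\<lambda>x. \<psi>' x * (lam x - x)) t / (t + 1)\<bar> \<le> 6 * D\<^sup>2 * lam d / (t + 1)\<^sup>2" ..
  then have \<psi>1: "\<And>t. t > 0 \<Longrightarrow> (mean \<psi> has_real_derivative \<psi>1 t) (at t)"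
    "\<And>t. t > 0 \<Longrightarrow> \<bar>\<psi>1 t - mean (\<lambda>x. \<psi>' x * (lam x - x)) t / (t + 1)\<bar> \<le> 6 * D\<^sup>2 * lam d / (t + 1)\<^sup>2"
    by simp_all
  have C_ge: "D * lam d / (t + 1)\<^sup>2 \<le> C / (t + 1)\<^sup>2" "6 * D\<^sup>2 * lam d / (t + 1)\<^sup>2 \<le> C / (t + 1)\<^sup>2" for t
    unfolding C_def using D lam_d by (intro divide_right_mono mult_right_mono; simp)+
  have "(mean \<psi> \<longlongrightarrow> 0) at_top"
  proof (rule tendsto_0_of_dissipation[where A = "\<lambda>t. \<sigma> * mean \<Phi> t" and A' = "\<lambda>t. \<sigma> * \<Phi>1 t"
        and B' = \<psi>1 and W = "mean w" and S = S and C = C and K = K and \<delta> = \<delta>])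
    fix t :: real assume t: "t > 0"
    show "((\<lambda>t. \<sigma> * mean \<Phi> t) has_real_derivative \<sigma> * \<Phi>1 t) (at t)"
      by (intro DERIV_cmult \<Phi>1 t)
    show "(mean \<psi> has_real_derivative \<psi>1 t) (at t)" by (intro \<psi>1 t)
    have \<Phi>_bound: "\<bar>\<Phi> x\<bar> \<le> D ^ 3" for x
    proof -
      have "D * (s x)\<^sup>2 \<le> D * D\<^sup>2" "0 \<le> D * (s x)\<^sup>2" using s[of x] D by auto
      moreover have "s x ^ 3 \<le> D ^ 3" "0 \<le> s x ^ 3" using s[of x] by (auto intro: power_mono)
      ultimately show ?thesis by (simp add: \<Phi>_def power2_eq_square power3_eq_cube abs_le_iff)
    qed
    have "\<bar>mean \<Phi> t\<bar> \<le> D ^ 3" by (rule abs_mean_le[of d]) (use zero t \<Phi>_bound in auto)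
    then show "\<bar>\<sigma> * mean \<Phi> t\<bar> \<le> S" using \<sigma> D by (auto simp: S_def intro: add_increasing2)
    have "\<bar>\<psi> x\<bar> \<le> D ^ 4" for x
      using power_mono[OF w_le w_nonneg, of x 2] by (simp add: \<psi>_def flip: power_mult)
    then have "\<bar>mean \<psi> t\<bar> \<le> D ^ 4" by (intro abs_mean_le[of d]) (use zero t in auto)
    then show "mean \<psi> t \<le> S" using D by (auto simp: S_def intro: add_increasing)
    \<comment> \<open>The zero function is written as \<open>0 * w\<close>, so that nonnegativity
      follows from monotonicity of the mean.\<close>
    have "0 * mean w t = mean (\<lambda>x. 0 * w x) t" by (rule mean_cmult[of d, symmetric]) (use zero t in auto)
    also have "\<dots> \<le> mean \<psi> t"
      by (rule mean_mono[of d]) (use zero t in \<open>auto simp: \<psi>_def\<close>)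
    finally show "0 \<le> mean \<psi> t" by simp
    have D2_le: "D\<^sup>2 \<le> K" using D lam_d \<open>0 \<le> d\<close> by (simp add: K_def)
    have \<psi>_le: "\<psi> x \<le> K * w x" for x
      unfolding \<psi>_def power2_eq_square[of "w x"]
      by (intro mult_right_mono order_trans[OF w_le D2_le] w_nonneg)
    have "mean \<psi> t \<le> mean (\<lambda>x. K * w x) t"
      by (rule mean_mono[of d]) (use zero t \<psi>_le in auto)
    also have "\<dots> = K * mean w t" by (rule mean_cmult[of d]) (use zero t in auto)
    finally show "mean \<psi> t \<le> K * mean w t" .
    have "\<delta> * mean w t = mean (\<lambda>x. \<delta> * w x) t"
      by (rule mean_cmult[of d, symmetric]) (use zero t in auto)
    also have "\<dots> \<le> mean (\<lambda>x. \<sigma> * (w x * (lam x - x))) t"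
    proof (rule mean_mono[of d])
      fix x :: real assume x: "0 \<le> x"
      show "\<delta> * w x \<le> \<sigma> * (w x * (lam x - x))"
      \<comment> \<open>The drift condition is available only on the support of \<open>w\<close>;
        elsewhere both sides are 0.\<close>
      proof (cases "c \<le> x \<and> x \<le> d")
        case True
        then show ?thesis using mult_left_mono[OF drift[OF x] w_nonneg[of x]] by (simp add: mult_ac)
      next
        case False
        then have "w x = 0" using zero(1)[of x] s_c[of x] by (auto simp: w_def)
        then show ?thesis by simp
      qed
    qed (use zero t in auto)
    also have "\<dots> = \<sigma> * mean (\<lambda>x. w x * (lam x - x)) t"
      by (rule mean_cmult[of d]) (use zero t in auto)
    finally have "\<delta> * mean w t / (t + 1) \<le> \<sigma> * mean (\<lambda>x. w x * (lam x - x)) t / (t + 1)"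
      using t by (intro divide_right_mono) auto
    then show "\<delta> * mean w t / (t + 1) - C / (t + 1)\<^sup>2 \<le> \<sigma> * \<Phi>1 t"
      using \<Phi>1(2)[OF t] C_ge(1)[of t] \<sigma> by (auto simp: abs_le_iff)
    have "- K * mean w t = mean (\<lambda>x. - K * w x) t"
      by (rule mean_cmult[of d, symmetric]) (use zero t in auto)
    also have "\<dots> \<le> mean (\<lambda>x. \<psi>' x * (lam x - x)) t"
    proof (rule mean_mono[of d])
      fix x :: real assume x: "0 \<le> x"
      show "- K * w x \<le> \<psi>' x * (lam x - x)"
      proof (cases "x \<le> d")
        case True
        have "lam x \<le> lam d" using True x by (intro mono_onD[OF lam_mono]) auto
        then have "\<bar>lam x - x\<bar> \<le> lam d + d" using lam_nonneg[OF x] lam_d x True by auto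
        then have "\<bar>\<psi>' x * (lam x - x)\<bar> \<le> 2 * w x * D * (lam d + d)"
          unfolding abs_mult \<psi>'_def using w_nonneg[of x] D2s[of x] D
          by (intro mult_mono) auto
        also have "\<dots> \<le> K * w x" using w_nonneg[of x] by (simp add: K_def algebra_simps)
        finally show ?thesis by (simp add: abs_le_iff)
      qed (use zero[of x] in auto)
    qed (use zero t in auto)
    finally have "- K * mean w t / (t + 1) \<le> mean (\<lambda>x. \<psi>' x * (lam x - x)) t / (t + 1)"
      using t by (intro divide_right_mono) auto
    then show "- (K * mean w t / (t + 1)) - C / (t + 1)\<^sup>2 \<le> \<psi>1 t"
      using \<psi>1(2)[OF t] C_ge(2)[of t] by (simp add: abs_le_iff)
  next
    show "K > 0" unfolding K_def using D lam_d \<open>0 \<le> d\<close> by (intro add_pos_nonneg) auto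
    show "C \<ge> 0" unfolding C_def using D lam_d by simp
  qed (rule \<delta>)
  moreover have "w x = max 0 (x - c) * max 0 (d - x)" for x
  proof (cases "c < x \<and> x < d")
    case True
    then have "s x = x - c" "max 0 (x - c) = x - c" "max 0 (d - x) = d - x" by (auto simp: s_def D_def)
    then show ?thesis by (simp only: w_def D_def) simp
  next
    case False
    then have "w x = 0" using zero(1)[of x] s_c[of x] by (auto simp: w_def)
    then show ?thesis using False by auto
  qed
  ultimately show ?thesis by (simp add: \<psi>_def[abs_def])
qed

end

section \<open>Paths: jump times, left limits and stopping\<close>

text \<open>The infimum is attained by right-continuity: a count below \<open>n\<close> at
  \<open>t\<close> stays below \<open>n\<close> on some interval to the right of
  \<open>t\<close>.\<close>

lemma jump_time_le_iff:
  assumes path: "counting_path (\<lambda>t. N t \<omega>)" and "0 \<le> t"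
  shows "jump_time N n \<omega> \<le> ereal t \<longleftrightarrow> enat n \<le> N t \<omega>"
proof
  assume "enat n \<le> N t \<omega>"
  then show "jump_time N n \<omega> \<le> ereal t"
    unfolding jump_time_def using \<open>0 \<le> t\<close> by (intro Inf_lower) auto
next
  assume le: "jump_time N n \<omega> \<le> ereal t"
  show "enat n \<le> N t \<omega>"
  proof (rule ccontr)
    assume "\<not> enat n \<le> N t \<omega>"
    then have less: "N t \<omega> < enat n" by simp
    have "((\<lambda>t. N t \<omega>) \<longlongrightarrow> N t \<omega>) (at_right t)"
      using path \<open>0 \<le> t\<close> by (simp add: counting_path_def continuous_within)
    from order_tendstoD(2)[OF this less] obtain b where b: "b > t" "\<And>y. t < y \<Longrightarrow> y < b \<Longrightarrow> N y \<omega> < enat n"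
      by (auto simp: eventually_at_right_field)
    have "ereal b \<le> jump_time N n \<omega>"
      unfolding jump_time_def
    proof (rule Inf_greatest, clarsimp)
      fix s assume s: "0 \<le> s" "enat n \<le> N s \<omega>"
      have mono: "mono_on {0..} (\<lambda>t. N t \<omega>)" using path by (simp add: counting_path_def)
      have "\<not> s \<le> t"
      proof
        assume "s \<le> t"
        then have "N s \<omega> \<le> N t \<omega>" using mono_onD[OF mono, of s t] s(1) \<open>0 \<le> t\<close> by simp
        then show False using s(2) less by simp
      qed
      then show "b \<le> s" using b(2)[of s] s(2) by force
    qed
    also note le
    finally show False using b(1) by simp
  qed
qed

lemma jump_time_nonneg: "0 \<le> jump_time N n \<omega>"
  unfolding jump_time_def by (intro Inf_greatest) auto

text \<open>The left limit counts only jumps strictly before \<open>u\<close>. If there are fewer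
  than \<open>k\<close> at each earlier time, integrality improves this to at most
  \<open>k - 1\<close>, a bound that passes to the supremum.\<close>

lemma le_left_lim_iff:
  assumes path: "counting_path (\<lambda>t. N t \<omega>)" and "0 < u"
  shows "enat k \<le> left_lim (\<lambda>t. N t \<omega>) u \<longleftrightarrow> jump_time N k \<omega> < ereal u"
proof
  assume "jump_time N k \<omega> < ereal u"
  then obtain s where "0 \<le> s" "s < u" "enat k \<le> N s \<omega>"
    unfolding jump_time_def Inf_less_iff by auto
  then show "enat k \<le> left_lim (\<lambda>t. N t \<omega>) u"
    unfolding left_lim_def by (intro SUP_upper2[of s]) auto
next
  assume le: "enat k \<le> left_lim (\<lambda>t. N t \<omega>) u"
  show "jump_time N k \<omega> < ereal u"
  proof (rule ccontr)
    assume ge: "\<not> jump_time N k \<omega> < ereal u"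
    have less: "N s \<omega> < enat k" if "0 \<le> s" "s < u" for s
    proof -
      have "\<not> jump_time N k \<omega> \<le> ereal s"
        using ge that less_le_trans[of "ereal s" "ereal u" "jump_time N k \<omega>"]
        by (simp add: not_less not_le)
      then show ?thesis using jump_time_le_iff[of N \<omega>, OF path that(1)] by simp
    qed
    then obtain j where j: "k = Suc j" using less[of 0] \<open>0 < u\<close> by (cases k) (auto simp: enat_0)
    have "N s \<omega> \<le> enat j" if "0 \<le> s" "s < u" for s
      using less[OF that] j by (cases "N s \<omega>") auto
    then have "left_lim (\<lambda>t. N t \<omega>) u \<le> enat j"
      unfolding left_lim_def by (intro SUP_least) auto
    then have "enat k \<le> enat j" by (rule order_trans[OF le])
    with j show False by simp
  qed
qed

text \<open>As jumps have size one, the count at the \<open>n\<close>-th jump time is exactly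
  \<open>n\<close>.\<close>

lemma stopped_eq_min:
  assumes path: "counting_path (\<lambda>t. N t \<omega>)" and "0 \<le> t"
  shows "stopped N n t \<omega> = min (N t \<omega>) (enat n)"
proof (cases "jump_time N n \<omega> \<le> ereal t")
  case True
  then obtain r where r: "jump_time N n \<omega> = ereal r" "0 \<le> r"
    using jump_time_nonneg[of N n \<omega>] by (cases "jump_time N n \<omega>") auto
  have "enat n \<le> N r \<omega>" using jump_time_le_iff[of N \<omega> r n] path r by simp
  moreover have "N r \<omega> \<le> enat n"
  proof (cases "r = 0")
    case True
    then show ?thesis using path by (simp add: counting_path_def)
  next
    case False
    then have "left_lim (\<lambda>t. N t \<omega>) r < enat n"
      using le_left_lim_iff[of N \<omega> r n] path r by auto
    then have "left_lim (\<lambda>t. N t \<omega>) r + 1 \<le> enat n" by (metis ileI1 plus_1_eSuc(2))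
    moreover have "N r \<omega> \<le> left_lim (\<lambda>t. N t \<omega>) r + 1"
      using path r False by (simp add: counting_path_def)
    ultimately show ?thesis by (rule order_trans[rotated])
  qed
  moreover have "enat n \<le> N t \<omega>" using jump_time_le_iff[of N \<omega>, OF path \<open>0 \<le> t\<close>] True by simp
  ultimately show ?thesis using True r by (simp add: stopped_def min_def)
next
  case False
  moreover have "min (ereal t) (jump_time N n \<omega>) = ereal t"
    using False by (intro min_absorb1) simp
  moreover have "N t \<omega> \<le> enat n"
    using jump_time_le_iff[of N \<omega>, OF path \<open>0 \<le> t\<close>, of n] False by simp
  ultimately show ?thesis by (simp add: stopped_def min_def)
qed

text \<open>Layer-cake form: a truncated count is the number of thresholds reached, so its
  expectation becomes a sum of tail probabilities.\<close>

lemma ennreal_of_enat_min_eq_sum: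
  "ennreal_of_enat (min x (enat n)) = (\<Sum>k<n. if enat (Suc k) \<le> x then 1 else 0)"
proof (induction n)
  case 0
  then show ?case by (simp add: enat_0)
next
  case (Suc n)
  have "ennreal_of_enat (min x (enat (Suc n))) =
      ennreal_of_enat (min x (enat n)) + (if enat (Suc n) \<le> x then 1 else 0)"
    by (cases x) (auto simp: min_def not_le add.commute le_Suc_eq)
  then show ?case using Suc by simp
qed

section \<open>From the intensity to the forward equation\<close>

locale self_exciting = prob_space M for M :: "'a measure" +
  fixes N :: "real \<Rightarrow> 'a \<Rightarrow> enat" and lam :: "real \<Rightarrow> real" and \<gamma> :: real
  assumes gamma_nonneg: "\<gamma> \<ge> 0"
    and lam_nonneg: "x \<ge> 0 \<Longrightarrow> lam x \<ge> 0"
    and lam_cont: "continuous_on {0..} lam"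
    and lam_mono: "mono_on {0..} lam"
    and process: "self_exciting_process M lam \<gamma> N"
begin

abbreviation \<tau> :: "nat \<Rightarrow> 'a \<Rightarrow> ereal" where "\<tau> \<equiv> jump_time N"

text \<open>Truncating \<open>u\<close> at \<open>0\<close> makes the rates continuous on the whole line.\<close>

definition rate :: "nat \<Rightarrow> real \<Rightarrow> real" where
  "rate k u = lam ((real k + \<gamma>) / (max 0 u + 1))"

text \<open>Phrased with the jump time rather than with \<open>N t\<close>, so that it makes sense
  at every real \<open>t\<close> and its event is jointly measurable in time and outcome.\<close>

definition q :: "nat \<Rightarrow> real \<Rightarrow> real" where
  "q k t = prob {\<omega> \<in> space M. \<tau> k \<omega> \<le> ereal t}"

lemma rate_nonneg: "0 \<le> rate k u"
  unfolding rate_def using gamma_nonneg by (intro lam_nonneg divide_nonneg_pos) auto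

lemma rate_cont: "continuous_on UNIV (rate k)"
  unfolding rate_def[abs_def]
  by (rule continuous_on_compose2[OF lam_cont])
    (use gamma_nonneg in \<open>auto intro!: continuous_intros divide_nonneg_pos simp: add_nonneg_eq_0_iff\<close>)

lemma path: "\<omega> \<in> space M \<Longrightarrow> counting_path (\<lambda>t. N t \<omega>)"
  using process by (simp add: self_exciting_process_def simple_point_process_def)

lemma measurable_N [measurable]: "0 \<le> t \<Longrightarrow> N t \<in> M \<rightarrow>\<^sub>M count_space UNIV"
  using process by (simp add: self_exciting_process_def simple_point_process_def)

lemma q_eq: "0 \<le> t \<Longrightarrow> q k t = prob {\<omega> \<in> space M. enat k \<le> N t \<omega>}"
  unfolding q_def using jump_time_le_iff[of N _ t k] path by (metis (mono_tags, lifting))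

lemma measurable_jump_time [measurable]: "\<tau> k \<in> borel_measurable M"
proof (rule borel_measurableI_le)
  fix y :: ereal
  show "{\<omega> \<in> space M. \<tau> k \<omega> \<le> y} \<in> sets M"
  proof (cases "\<exists>s\<ge>0. y = ereal s")
    case True
    then obtain s where s: "0 \<le> s" "y = ereal s" by blast
    have "{\<omega> \<in> space M. \<tau> k \<omega> \<le> y} = {\<omega> \<in> space M. enat k \<le> N s \<omega>}"
      using s path jump_time_le_iff[of N _ s k] by auto
    also have "\<dots> = N s -` {enat k..} \<inter> space M" by auto
    also have "\<dots> \<in> sets M" using measurable_N[OF s(1)] by (rule measurable_sets) simp
    finally show ?thesis .
  next
    case False
    then have "y = \<infinity> \<or> y < 0" by (cases y) auto
    then have "{\<omega> \<in> space M. \<tau> k \<omega> \<le> y} = space M \<or> {\<omega> \<in> space M. \<tau> k \<omega> \<le> y} = {}"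
      by (auto dest: order_trans[OF jump_time_nonneg] leD)
    then show ?thesis by (elim disjE) (simp_all only: sets.top sets.empty_sets)
  qed
qed

text \<open>Reading the difference as a probability later supplies its nonnegativity and its
  measurability in \<open>u\<close>.\<close>

lemma prob_between_jumps:
  "prob {\<omega> \<in> space M. \<tau> k \<omega> \<le> ereal u \<and> ereal u < \<tau> (Suc k) \<omega>} = q k u - q (Suc k) u"
proof -
  have mono: "\<tau> k \<omega> \<le> \<tau> (Suc k) \<omega>" for \<omega>
    unfolding jump_time_def
  proof (rule Inf_superset_mono, clarsimp)
    fix t :: real assume "0 \<le> t" and le: "enat (Suc k) \<le> N t \<omega>"
    have "enat k \<le> enat (Suc k)" by simp
    then show "enat k \<le> N t \<omega>" using le by (rule order_trans)
  qed
  have "{\<omega> \<in> space M. \<tau> k \<omega> \<le> ereal u \<and> ereal u < \<tau> (Suc k) \<omega>} =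
      {\<omega> \<in> space M. \<tau> k \<omega> \<le> ereal u} - {\<omega> \<in> space M. \<tau> (Suc k) \<omega> \<le> ereal u}"
    by auto
  moreover have "{\<omega> \<in> space M. \<tau> (Suc k) \<omega> \<le> ereal u} \<subseteq> {\<omega> \<in> space M. \<tau> k \<omega> \<le> ereal u}"
    using mono by (auto intro: order_trans)
  ultimately show ?thesis
    unfolding q_def by (simp only:) (rule finite_measure_Diff; measurable)
qed

text \<open>The part of the compensator accumulated while the count equals \<open>k\<close>. The
  interval is closed on the left, as for \<open>N u \<omega> = k\<close>, although the intensity
  depends on the left limit.\<close>

definition occupation :: "nat \<Rightarrow> real \<Rightarrow> 'a \<Rightarrow> ennreal" where
  "occupation k t \<omega> = (\<integral>\<^sup>+u. ennreal (rate k u) *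
     indicator {u. 0 \<le> u \<and> u \<le> t \<and> \<tau> k \<omega> \<le> ereal u \<and> ereal u < \<tau> (Suc k) \<omega>} u \<partial>lborel)"

lemma measurable_rate [measurable]: "rate k \<in> borel_measurable borel"
  by (rule borel_measurable_continuous_onI[OF rate_cont])

lemma measurable_occupation [measurable]: "occupation k t \<in> borel_measurable M"
  unfolding occupation_def[abs_def] by measurable

text \<open>Up to the \<open>n\<close>-th jump time the left limit is some \<open>k < n\<close>, and
  splitting by its value leaves the deterministic rate on each piece.\<close>

lemma compensator_eq:
  assumes "\<omega> \<in> space M"
  shows "(\<integral>\<^sup>+u. self_exciting_intensity lam \<gamma> N u \<omega> *
      indicator {u. 0 < u \<and> u \<le> t \<and> ereal u \<le> \<tau> n \<omega>} u \<partial>lborel) = (\<Sum>k<n. occupation k t \<omega>)"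
proof -
  have left_lim_eq: "left_lim (\<lambda>t. N t \<omega>) u = enat k \<longleftrightarrow> \<tau> k \<omega> < ereal u \<and> ereal u \<le> \<tau> (Suc k) \<omega>"
    if "0 < u" for u k
  proof -
    have "left_lim (\<lambda>t. N t \<omega>) u = enat k \<longleftrightarrow>
      enat k \<le> left_lim (\<lambda>t. N t \<omega>) u \<and> \<not> enat (Suc k) \<le> left_lim (\<lambda>t. N t \<omega>) u"
      by (cases "left_lim (\<lambda>t. N t \<omega>) u") auto
    then show ?thesis using le_left_lim_iff[of N \<omega>, OF path[OF assms] that] by (simp add: not_less)
  qed
  have "self_exciting_intensity lam \<gamma> N u \<omega> * indicator {u. 0 < u \<and> u \<le> t \<and> ereal u \<le> \<tau> n \<omega>} u =
    (\<Sum>k<n. ennreal (rate k u) *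
      indicator {u. 0 < u \<and> u \<le> t \<and> \<tau> k \<omega> < ereal u \<and> ereal u \<le> \<tau> (Suc k) \<omega>} u)" for u
  proof (cases "0 < u \<and> u \<le> t")
    case u: True
    have "(\<Sum>k<n. ennreal (rate k u) *
        indicator {u. 0 < u \<and> u \<le> t \<and> \<tau> k \<omega> < ereal u \<and> ereal u \<le> \<tau> (Suc k) \<omega>} u) =
        (\<Sum>k<n. if left_lim (\<lambda>t. N t \<omega>) u = enat k then ennreal (rate k u) else 0)"
      using u by (intro sum.cong) (auto simp: left_lim_eq)
    moreover have "ereal u \<le> \<tau> n \<omega> \<longleftrightarrow> left_lim (\<lambda>t. N t \<omega>) u < enat n"
      using le_left_lim_iff[of N \<omega>, OF path[OF assms], of u n] u by auto
    ultimately show ?thesis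
      using u by (cases "left_lim (\<lambda>t. N t \<omega>) u")
        (auto simp: self_exciting_intensity_def rate_def indicator_def)
  qed auto
  then have "(\<integral>\<^sup>+u. self_exciting_intensity lam \<gamma> N u \<omega> *
      indicator {u. 0 < u \<and> u \<le> t \<and> ereal u \<le> \<tau> n \<omega>} u \<partial>lborel) =
    (\<Sum>k<n. \<integral>\<^sup>+u. ennreal (rate k u) *
      indicator {u. 0 < u \<and> u \<le> t \<and> \<tau> k \<omega> < ereal u \<and> ereal u \<le> \<tau> (Suc k) \<omega>} u \<partial>lborel)"
    by (subst nn_integral_sum[symmetric]) (simp_all only:, measurable)
  also have "\<dots> = (\<Sum>k<n. occupation k t \<omega>)"
    unfolding occupation_def
  proof (intro sum.cong refl nn_integral_cong_AE)
    fix k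
    show "AE u in lborel. ennreal (rate k u) *
        indicator {u. 0 < u \<and> u \<le> t \<and> \<tau> k \<omega> < ereal u \<and> ereal u \<le> \<tau> (Suc k) \<omega>} u =
        ennreal (rate k u) *
        indicator {u. 0 \<le> u \<and> u \<le> t \<and> \<tau> k \<omega> \<le> ereal u \<and> ereal u < \<tau> (Suc k) \<omega>} u"
      \<comment> \<open>The indicators differ at most at 0 and at the two jump times. An infinite
        jump time is sent to 0 by \<open>real_of_ereal\<close>, which excludes no further
        point.\<close>
      using AE_lborel_singleton[of 0] AE_lborel_singleton[of "real_of_ereal (\<tau> k \<omega>)"]
        AE_lborel_singleton[of "real_of_ereal (\<tau> (Suc k) \<omega>)"]
    proof eventually_elim
      case (elim u)
      then have "ereal u \<noteq> \<tau> k \<omega>" "ereal u \<noteq> \<tau> (Suc k) \<omega>" by (metis real_of_ereal.simps(1))+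
      then show ?case using elim by (auto simp: indicator_def order.order_iff_strict)
    qed
  qed
  finally show ?thesis .
qed

text \<open>Tonelli: the rate is deterministic, so the inner integral is a probability at a fixed
  time.\<close>

lemma nn_integral_occupation:
  "(\<integral>\<^sup>+\<omega>. occupation k t \<omega> \<partial>M) =
    (\<integral>\<^sup>+u. ennreal (indicator {0..t} u * (rate k u * (q k u - q (Suc k) u))) \<partial>lborel)"
proof -
  interpret pair_sigma_finite M lborel by unfold_locales
  have "(\<integral>\<^sup>+\<omega>. occupation k t \<omega> \<partial>M) = (\<integral>\<^sup>+u. (\<integral>\<^sup>+\<omega>. ennreal (rate k u) *
     indicator {u. 0 \<le> u \<and> u \<le> t \<and> \<tau> k \<omega> \<le> ereal u \<and> ereal u < \<tau> (Suc k) \<omega>} u \<partial>M) \<partial>lborel)"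
    unfolding occupation_def by (rule Fubini'[symmetric]) measurable
  also have "\<dots> = (\<integral>\<^sup>+u. ennreal (indicator {0..t} u * (rate k u * (q k u - q (Suc k) u))) \<partial>lborel)"
  proof (rule nn_integral_cong)
    fix u :: real
    have "(\<integral>\<^sup>+\<omega>. ennreal (rate k u) *
        indicator {u. 0 \<le> u \<and> u \<le> t \<and> \<tau> k \<omega> \<le> ereal u \<and> ereal u < \<tau> (Suc k) \<omega>} u \<partial>M) =
      (\<integral>\<^sup>+\<omega>. ennreal (indicator {0..t} u * rate k u) *
        indicator {\<omega> \<in> space M. \<tau> k \<omega> \<le> ereal u \<and> ereal u < \<tau> (Suc k) \<omega>} \<omega> \<partial>M)"
      by (rule nn_integral_cong) (auto simp: indicator_def)
    also have "\<dots> = ennreal (indicator {0..t} u * rate k u) *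
        emeasure M {\<omega> \<in> space M. \<tau> k \<omega> \<le> ereal u \<and> ereal u < \<tau> (Suc k) \<omega>}"
      by (rule nn_integral_cmult_indicator) measurable
    also have "\<dots> = ennreal (indicator {0..t} u * (rate k u * (q k u - q (Suc k) u)))"
      unfolding emeasure_eq_measure prob_between_jumps[symmetric]
      by (simp add: ennreal_mult'[symmetric] rate_nonneg mult_ac)
    finally show "(\<integral>\<^sup>+\<omega>. ennreal (rate k u) *
        indicator {u. 0 \<le> u \<and> u \<le> t \<and> \<tau> k \<omega> \<le> ereal u \<and> ereal u < \<tau> (Suc k) \<omega>} u \<partial>M) =
      ennreal (indicator {0..t} u * (rate k u * (q k u - q (Suc k) u)))" .
  qed
  finally show ?thesis .
qed

text \<open>Expectation of the intensity identity on the interval from 0 to \<open>t\<close> for the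
  process stopped at its \<open>n\<close>-th jump. The left side is the mean of \<open>N t\<close>
  truncated at \<open>n\<close>.\<close>

lemma sum_q_eq_sum_occupation:
  assumes "0 \<le> t"
  shows "(\<Sum>k<n. ennreal (q (Suc k) t)) = (\<Sum>k<n. \<integral>\<^sup>+\<omega>. occupation k t \<omega> \<partial>M)"
proof -
  let ?F = "natural_filtration M N 0"
  let ?f = "\<lambda>\<omega>. ennreal_of_enat (stopped N n t \<omega> - stopped N n 0 \<omega>)"
  let ?g = "\<lambda>\<omega>. \<integral>\<^sup>+u. self_exciting_intensity lam \<gamma> N u \<omega> *
      indicator {u. 0 < u \<and> u \<le> t \<and> ereal u \<le> \<tau> n \<omega>} u \<partial>lborel"
  have "subalgebra M ?F"
  proof -
    have "{N s -` A \<inter> space M |s A. 0 \<le> s \<and> s \<le> 0} \<subseteq> sets M"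
      by (auto intro!: measurable_sets[OF measurable_N])
    moreover from this have "{N s -` A \<inter> space M |s A. 0 \<le> s \<and> s \<le> 0} \<subseteq> Pow (space M)"
      using sets.sets_into_space by blast
    ultimately show ?thesis
      unfolding subalgebra_def natural_filtration_def
      by (simp add: space_measure_of_conv sets.sigma_sets_subset del: Collect_conj_eq)
  qed
  then interpret finite_measure_subalgebra M ?F by unfold_locales
  have f_eq: "?f \<omega> = (\<Sum>k<n. indicator {\<omega> \<in> space M. enat (Suc k) \<le> N t \<omega>} \<omega>)" if "\<omega> \<in> space M" for \<omega>
  proof -
    have "N 0 \<omega> = 0" using path[OF that] by (simp add: counting_path_def)
    then show ?thesis
      using that stopped_eq_min[of N \<omega>, OF path[OF that], of _ n] assms
      by (simp add: ennreal_of_enat_min_eq_sum indicator_def of_bool_def)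
  qed
  have [measurable]: "{\<omega> \<in> space M. enat (Suc k) \<le> N t \<omega>} \<in> sets M" for k
    using measurable_sets[OF measurable_N[OF assms], of "{enat (Suc k)..}"]
    by (simp add: vimage_def Int_def conj_commute)
  have f: "?f \<in> borel_measurable M"
    by (rule measurable_cong[THEN iffD2, OF f_eq]) auto
  have g: "?g \<in> borel_measurable M"
    by (rule measurable_cong[THEN iffD2, OF compensator_eq]) auto
  have "AE \<omega> in M. nn_cond_exp M ?F ?f \<omega> = nn_cond_exp M ?F ?g \<omega>"
    using process assms unfolding self_exciting_process_def has_intensity_def by blast
  \<comment> \<open>The factor 1 is the test function that \<open>nn_cond_exp_intg\<close> asks for;
    it removes the conditioning.\<close>
  then have "(\<integral>\<^sup>+\<omega>. 1 * nn_cond_exp M ?F ?f \<omega> \<partial>M) = (\<integral>\<^sup>+\<omega>. 1 * nn_cond_exp M ?F ?g \<omega> \<partial>M)"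
    by (intro nn_integral_cong_AE) auto
  also have "(\<integral>\<^sup>+\<omega>. 1 * nn_cond_exp M ?F ?f \<omega> \<partial>M) = (\<integral>\<^sup>+\<omega>. 1 * ?f \<omega> \<partial>M)"
    by (rule nn_cond_exp_intg[OF _ f]) simp
  also have "(\<integral>\<^sup>+\<omega>. 1 * nn_cond_exp M ?F ?g \<omega> \<partial>M) = (\<integral>\<^sup>+\<omega>. 1 * ?g \<omega> \<partial>M)"
    by (rule nn_cond_exp_intg[OF _ g]) simp
  finally have eq: "(\<integral>\<^sup>+\<omega>. ?f \<omega> \<partial>M) = (\<integral>\<^sup>+\<omega>. ?g \<omega> \<partial>M)" by (simp only: mult_1)
  have "(\<integral>\<^sup>+\<omega>. ?f \<omega> \<partial>M) =
      (\<integral>\<^sup>+\<omega>. (\<Sum>k<n. indicator {\<omega> \<in> space M. enat (Suc k) \<le> N t \<omega>} \<omega>) \<partial>M)"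
    by (rule nn_integral_cong) (rule f_eq)
  also have "\<dots> = (\<Sum>k<n. ennreal (q (Suc k) t))"
    by (simp add: nn_integral_sum q_eq[OF assms] emeasure_eq_measure)
  finally have f_int: "(\<integral>\<^sup>+\<omega>. ?f \<omega> \<partial>M) = (\<Sum>k<n. ennreal (q (Suc k) t))" .
  have "(\<integral>\<^sup>+\<omega>. ?g \<omega> \<partial>M) = (\<integral>\<^sup>+\<omega>. (\<Sum>k<n. occupation k t \<omega>) \<partial>M)"
    by (rule nn_integral_cong) (rule compensator_eq)
  also have "\<dots> = (\<Sum>k<n. \<integral>\<^sup>+\<omega>. occupation k t \<omega> \<partial>M)"
    by (rule nn_integral_sum) simp
  finally show ?thesis using eq f_int by (simp only:)
qed

text \<open>Difference of the identities for \<open>n = Suc k\<close> and \<open>n = k\<close>;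
  cancellation in \<open>ennreal\<close> is legitimate because the common sum is finite.\<close>

lemma q_Suc_eq_occupation:
  assumes "0 \<le> t"
  shows "(\<integral>\<^sup>+\<omega>. occupation k t \<omega> \<partial>M) = ennreal (q (Suc k) t)"
proof -
  have "(\<Sum>j<k. ennreal (q (Suc j) t)) + ennreal (q (Suc k) t) =
      (\<Sum>j<k. ennreal (q (Suc j) t)) + (\<integral>\<^sup>+\<omega>. occupation k t \<omega> \<partial>M)"
    using sum_q_eq_sum_occupation[OF assms, of k] sum_q_eq_sum_occupation[OF assms, of "Suc k"]
    by simp
  moreover have "(\<Sum>j<k. ennreal (q (Suc j) t)) \<noteq> \<infinity>" by (simp add: sum_ennreal q_def)
  ultimately show ?thesis by (simp only: ennreal_add_left_cancel) simp
qed

lemma q_has_integral: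
  assumes "0 \<le> t"
  shows "((\<lambda>u. rate k u * (q k u - q (Suc k) u)) has_integral q (Suc k) t) {0..t}"
proof -
  let ?g = "\<lambda>u. indicator {0..t} u * (rate k u * (q k u - q (Suc k) u))"
  have "(?g has_integral q (Suc k) t) UNIV"
  proof (rule nn_integral_has_integral)
    show "?g \<in> borel_measurable borel"
      unfolding prob_between_jumps[symmetric] by measurable
    show "0 \<le> ?g u" for u
      unfolding prob_between_jumps[symmetric] using rate_nonneg by simp
    show "0 \<le> q (Suc k) t" by (simp add: q_def)
    show "(\<integral>\<^sup>+u. ennreal (?g u) \<partial>lborel) = ennreal (q (Suc k) t)"
      using q_Suc_eq_occupation[OF assms, of k] nn_integral_occupation[of k t] by simp
  qed
  moreover have "?g = (\<lambda>u. if u \<in> {0..t} then rate k u * (q k u - q (Suc k) u) else 0)"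
    by (auto simp: indicator_def)
  ultimately show ?thesis by (simp only: has_integral_restrict_UNIV)
qed

lemma q_0: "0 \<le> t \<Longrightarrow> q 0 t = 1"
  using prob_space by (simp add: q_eq enat_0)

lemma q_Suc_eq_integral:
  "0 \<le> t \<Longrightarrow> q (Suc k) t = integral {0..t} (\<lambda>u. rate k u * (q k u - q (Suc k) u))"
  using q_has_integral[THEN integral_unique] by simp

text \<open>First half of a bootstrap: an indefinite integral is continuous for a merely integrable
  integrand. That makes the integrand itself continuous, and \<open>q_deriv\<close> can use the
  fundamental theorem of calculus.\<close>

lemma q_cont: "continuous_on {0..T} (q k)"
proof (cases k)
  case 0
  then show ?thesis using q_0 by (intro continuous_on_eq[OF continuous_on_const[of _ 1]]) auto
next
  case (Suc j)
  show ?thesis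
  proof (cases "0 \<le> T")
    case True
    have "continuous_on {0..T} (\<lambda>t. integral {0..t} (\<lambda>u. rate j u * (q j u - q (Suc j) u)))"
      by (rule indefinite_integral_continuous_1) (use q_has_integral[OF True] in blast)
    then show ?thesis
      by (rule continuous_on_eq) (use Suc q_Suc_eq_integral[of _ j] in auto)
  qed simp
qed

lemma q_deriv:
  assumes "0 < t"
  shows "(q (Suc k) has_real_derivative lam ((real k + \<gamma>) / (t + 1)) * (q k t - q (Suc k) t)) (at t)"
proof -
  let ?g = "\<lambda>u. rate k u * (q k u - q (Suc k) u)"
  \<comment> \<open>The right end \<open>t + 1\<close> only serves to make \<open>t\<close> an
    interior point.\<close>
  have "continuous_on {0..t + 1} ?g"
    by (intro continuous_intros q_cont continuous_on_subset[OF rate_cont]) auto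
  then have "((\<lambda>t. integral {0..t} ?g) has_real_derivative ?g t) (at t within {0..t + 1})"
    by (rule integral_has_real_derivative) (use assms in auto)
  then have "((\<lambda>t. integral {0..t} ?g) has_real_derivative ?g t) (at t)"
    using assms by (simp add: at_within_Icc_at)
  then have "(q (Suc k) has_real_derivative ?g t) (at t)"
    by (rule has_field_derivative_transform_within_open[of _ _ _ "{0<..}"])
      (use assms q_Suc_eq_integral in auto)
  then show ?thesis using assms by (simp add: rate_def)
qed

end

section \<open>A drift of constant sign around the interval\<close>

text \<open>The intermediate value theorem fixes the sign on the interval, openness extends it to a
  slightly larger one, and compactness gives the uniform bound.\<close>

lemma uniform_drift_around_interval:
  fixes lam :: "real \<Rightarrow> real"
  assumes cont: "continuous_on {0..} lam" and "0 \<le> a" "a \<le> b"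
    and no_fixed: "\<And>x. a \<le> x \<Longrightarrow> x \<le> b \<Longrightarrow> lam x \<noteq> x"
  obtains c d \<sigma> \<delta> where "c < a" "b < d" "\<sigma> = 1 \<or> \<sigma> = - 1" "\<delta> > 0"
    "\<And>x. 0 \<le> x \<Longrightarrow> c \<le> x \<Longrightarrow> x \<le> d \<Longrightarrow> \<delta> \<le> \<sigma> * (lam x - x)"
proof -
  \<comment> \<open>Extended by a constant to negative arguments, since for \<open>a = 0\<close> the
    enlarged interval reaches below 0.\<close>
  define g where "g x = lam (max 0 x) - max 0 x" for x
  define \<sigma> :: real where "\<sigma> = (if g a > 0 then 1 else - 1)"
  have \<sigma>: "\<sigma> = 1 \<or> \<sigma> = - 1" by (simp add: \<sigma>_def)
  have g_cont: "continuous_on S g" for S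
    unfolding g_def[abs_def]
    by (intro continuous_on_diff continuous_on_compose2[OF cont] continuous_intros) auto
  have g_nz: "g x \<noteq> 0" if "a \<le> x" "x \<le> b" for x
    using no_fixed[OF that] \<open>0 \<le> a\<close> that by (simp add: g_def)
  define U where "U = {x. 0 < \<sigma> * g x}"
  have "open U" unfolding U_def
    by (intro open_Collect_less continuous_intros g_cont)
  have U: "x \<in> U" if "a \<le> x" "x \<le> b" for x
  proof (rule ccontr)
    assume "x \<notin> U"
    then have "\<sigma> * g x \<le> 0" by (simp add: U_def)
    moreover have "0 \<le> \<sigma> * g a" using g_nz[of a] \<open>a \<le> b\<close> by (auto simp: \<sigma>_def)
    moreover have "continuous_on {a..x} (\<lambda>x. \<sigma> * g x)" by (intro continuous_intros g_cont)
    ultimately have "\<exists>y\<ge>a. y \<le> x \<and> \<sigma> * g y = 0"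
      using that(1) by (intro IVT2'[of "\<lambda>x. \<sigma> * g x"])
    then obtain y where "a \<le> y" "y \<le> x" "\<sigma> * g y = 0" by (elim exE conjE)
    then show False using g_nz[of y] \<sigma> that by auto
  qed
  obtain e1 where e1: "e1 > 0" "cball a e1 \<subseteq> U"
    using \<open>open U\<close> U[of a] \<open>a \<le> b\<close> open_contains_cball by blast
  obtain e2 where e2: "e2 > 0" "cball b e2 \<subseteq> U"
    using \<open>open U\<close> U[of b] \<open>a \<le> b\<close> open_contains_cball by blast
  have sub: "x \<in> U" if "a - e1 \<le> x" "x \<le> b + e2" for x
  proof -
    consider "x < a" | "a \<le> x" "x \<le> b" | "b < x" by linarith
    then show ?thesis
    proof cases
      case 1
      then show ?thesis using e1 that by (intro subsetD[OF e1(2)]) (auto simp: dist_real_def)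
    next
      case 2
      then show ?thesis by (rule U)
    next
      case 3
      then show ?thesis using e2 that by (intro subsetD[OF e2(2)]) (auto simp: dist_real_def)
    qed
  qed
  have "\<exists>y\<in>{a - e1..b + e2}. \<forall>x\<in>{a - e1..b + e2}. \<sigma> * g y \<le> \<sigma> * g x"
    using e1(1) e2(1) \<open>a \<le> b\<close>
    by (intro continuous_attains_inf continuous_intros g_cont) auto
  then obtain y where y: "a - e1 \<le> y" "y \<le> b + e2"
    "\<And>x. a - e1 \<le> x \<Longrightarrow> x \<le> b + e2 \<Longrightarrow> \<sigma> * g y \<le> \<sigma> * g x"
    by auto
  show ?thesis
  proof (rule that[of "a - e1" "b + e2" \<sigma> "\<sigma> * g y"])
    show "\<sigma> * g y > 0" using sub[OF y(1,2)] by (simp add: U_def)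
    show "\<sigma> * g y \<le> \<sigma> * (lam x - x)" if "0 \<le> x" "a - e1 \<le> x" "x \<le> b + e2" for x
      using y(3)[OF that(2,3)] that(1) by (simp add: g_def)
  qed (use e1 e2 \<sigma> in auto)
qed

section \<open>Transfer to the probabilities of the rescaled process\<close>

context self_exciting
begin

lemma q_Suc_le: "q (Suc k) t \<le> q k t"
  using measure_nonneg[of M "{\<omega> \<in> space M. \<tau> k \<omega> \<le> ereal t \<and> ereal t < \<tau> (Suc k) \<omega>}"]
  unfolding prob_between_jumps by simp

sublocale law: forward_equation lam \<gamma> q
  by unfold_locales
    (use gamma_nonneg lam_nonneg lam_mono q_0 q_Suc_le q_deriv in \<open>auto simp: q_def\<close>)

lemma prob_N_eq:
  assumes "0 \<le> t"
  shows "prob {\<omega> \<in> space M. N t \<omega> = enat n} = law.p n t"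
proof -
  have "N t \<omega> = enat n \<longleftrightarrow> \<tau> n \<omega> \<le> ereal t \<and> ereal t < \<tau> (Suc n) \<omega>" if "\<omega> \<in> space M" for \<omega>
    using jump_time_le_iff[of N \<omega>, OF path[OF that] assms, of n]
      jump_time_le_iff[of N \<omega>, OF path[OF that] assms, of "Suc n"]
    by (cases "N t \<omega>") (auto simp: not_le[symmetric])
  then have "{\<omega> \<in> space M. N t \<omega> = enat n} =
      {\<omega> \<in> space M. \<tau> n \<omega> \<le> ereal t \<and> ereal t < \<tau> (Suc n) \<omega>}"
    by blast
  then show ?thesis by (simp only: prob_between_jumps law.p_def)
qed

text \<open>Markov's inequality for \<open>f\<close> at the rescaled process, on an event that
  excludes explosion.\<close>

lemma prob_le_mean:
  assumes t: "0 < t" and zero: "\<And>x. x \<ge> d \<Longrightarrow> f x = 0" and nonneg: "\<And>x. 0 \<le> f x"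
    and "0 < m" and P: "\<And>n. P n \<Longrightarrow> m \<le> f (law.level n t)"
    and event: "\<And>\<omega>. \<omega> \<in> A \<Longrightarrow> \<omega> \<in> space M \<and> (\<exists>n. N t \<omega> = enat n \<and> P n)"
  shows "prob A \<le> law.mean f t / m"
proof -
  obtain K where K: "d * (t + 1) \<le> real K" using real_arch_simple by blast
  define S where "S = {n. n < K \<and> P n}"
  \<comment> \<open>A level at which \<open>f\<close> is positive lies below \<open>d\<close>, so
    finitely many counts cover the event.\<close>
  have S: "n \<in> S" if "P n" for n
    using P[OF that] law.level_ge[OF t K, of n] zero[of "law.level n t"] that \<open>0 < m\<close>
    by (force simp: S_def)
  have "finite S" by (simp add: S_def)
  have sets: "{\<omega> \<in> space M. N t \<omega> = enat n} \<in> events" for n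
    using measurable_sets[OF measurable_N, of t "{enat n}"] t
    by (simp add: vimage_def Int_def conj_commute)
  have "prob A \<le> prob (\<Union>n\<in>S. {\<omega> \<in> space M. N t \<omega> = enat n})"
  proof (rule finite_measure_mono)
    show "A \<subseteq> (\<Union>n\<in>S. {\<omega> \<in> space M. N t \<omega> = enat n})" using event S by fast
  qed (use sets \<open>finite S\<close> in auto)
  also have "\<dots> \<le> (\<Sum>n\<in>S. law.p n t)"
    using finite_measure_subadditive_finite[OF \<open>finite S\<close>, of "\<lambda>n. {\<omega> \<in> space M. N t \<omega> = enat n}"]
      sets t by (simp add: prob_N_eq image_subset_iff)
  finally have "m * prob A \<le> m * (\<Sum>n\<in>S. law.p n t)" using \<open>0 < m\<close> by simp
  also have "\<dots> = (\<Sum>n\<in>S. m * law.p n t)" by (simp add: sum_distrib_left)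
  also have "\<dots> \<le> (\<Sum>n\<in>S. f (law.level n t) * law.p n t)"
    using P law.p_nonneg[OF t] by (intro sum_mono mult_right_mono) (auto simp: S_def)
  also have "\<dots> \<le> (\<Sum>n<K. f (law.level n t) * law.p n t)"
    using law.p_nonneg[OF t] nonneg by (intro sum_mono2) (auto simp: S_def)
  also have "\<dots> = law.mean f t" by (rule law.mean_eq_sum[symmetric, OF zero t K])
  finally show ?thesis using \<open>0 < m\<close> by (simp add: field_simps)
qed

end

text \<open>The finite upper end excludes explosion, and counts being nonnegative allows
  \<open>a\<close> to be replaced by \<open>max 0 a\<close>.\<close>

lemma ereal_of_enat_divide_in_interval:
  assumes "0 < t" "ereal_of_enat x / ereal t \<in> {ereal a..ereal b}"
  shows "\<exists>n. x = enat n \<and> max 0 a \<le> real n / t \<and> real n / t \<le> b"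
  using assms by (cases x) auto

theorem theorem4:
  fixes M :: "'a measure" and N :: "real \<Rightarrow> 'a \<Rightarrow> enat"
    and lam :: "real \<Rightarrow> real" and \<gamma> a b :: real
  assumes "prob_space M"
    and "\<gamma> \<ge> 0"
    and "\<forall>x\<ge>0. lam x \<ge> 0"
    and "continuous_on {0..} lam"
    and "mono_on {0..} lam"
    and "self_exciting_process M lam \<gamma> N"
    and "\<not> (\<exists>x\<ge>0. x = lam x \<and> x \<in> {a..b})"
  shows "((\<lambda>t::real. \<P>(\<omega> in M. ereal_of_enat (N t \<omega>) / ereal t \<in> {ereal a..ereal b}))
           \<longlongrightarrow> 0) at_top"
proof (cases "max 0 a \<le> b")
  \<comment> \<open>The interval is empty or lies below 0, so the event is empty for every positive
    time.\<close>
  case False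
  have "\<forall>\<^sub>F t in at_top. \<P>(\<omega> in M. ereal_of_enat (N t \<omega>) / ereal t \<in> {ereal a..ereal b}) = 0"
    using eventually_gt_at_top[of 0]
  proof eventually_elim
    case (elim t)
    then have "{\<omega> \<in> space M. ereal_of_enat (N t \<omega>) / ereal t \<in> {ereal a..ereal b}} = {}"
      using ereal_of_enat_divide_in_interval[OF elim, of _ a b] False by fastforce
    then show ?case by (simp only: measure_empty)
  qed
  then show ?thesis by (rule tendsto_eventually)
next
  case True
  interpret self_exciting M N lam \<gamma>
    using assms by (simp add: self_exciting_def self_exciting_axioms_def)
  obtain c d \<sigma> \<delta> where cd: "c < max 0 a" "b < d" and \<sigma>: "\<sigma> = 1 \<or> \<sigma> = - 1" and \<delta>: "\<delta> > 0"
    and drift: "\<And>x. 0 \<le> x \<Longrightarrow> c \<le> x \<Longrightarrow> x \<le> d \<Longrightarrow> \<delta> \<le> \<sigma> * (lam x - x)"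
  proof (rule uniform_drift_around_interval[OF assms(4) _ True])
    show "lam x \<noteq> x" if "max 0 a \<le> x" "x \<le> b" for x
      using assms(7) that by (metis atLeastAtMost_iff max.bounded_iff)
  qed auto
  define \<psi> where "\<psi> x = (max 0 (x - c) * max 0 (d - x))\<^sup>2" for x
  \<comment> \<open>Half the smaller margin: a point of the interval displaced by at most
    \<open>\<eta>\<close> stays at distance at least \<open>\<eta>\<close> from \<open>c\<close> and
    \<open>d\<close>, where \<open>\<psi>\<close> is bounded below.\<close>
  define \<eta> where "\<eta> = min (max 0 a - c) (d - b) / 2"
  have \<eta>: "\<eta> > 0" "c + 2 * \<eta> \<le> max 0 a" "b + 2 * \<eta> \<le> d"
    using cd by (auto simp: \<eta>_def min_def)
  have \<psi>_ge: "(\<eta> * \<eta>)\<^sup>2 \<le> \<psi> x" if "c + \<eta> \<le> x" "x \<le> d - \<eta>" for x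
    unfolding \<psi>_def using that \<eta>(1) by (intro power_mono mult_mono) auto
  have lim: "(law.mean \<psi> \<longlongrightarrow> 0) at_top"
    unfolding \<psi>_def[abs_def]
    by (rule law.mean_tendsto_0[OF _ _ \<sigma> \<delta> drift]) (use cd True in auto)
  have le: "\<forall>\<^sub>F t in at_top. \<P>(\<omega> in M. ereal_of_enat (N t \<omega>) / ereal t \<in> {ereal a..ereal b}) \<le>
      law.mean \<psi> t / (\<eta> * \<eta>)\<^sup>2"
    \<comment> \<open>From this time on, \<open>real n / t\<close> in the interval and
      \<open>law.level n t\<close> differ by at most
      \<open>(\<gamma> + b) / (t + 1) \<le> \<eta>\<close>.\<close>
    using eventually_gt_at_top[of 0] eventually_ge_at_top[of "(\<gamma> + b) / \<eta>"]
  proof eventually_elim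
    case (elim t)
    show ?case
    proof (rule prob_le_mean[where P = "\<lambda>n. max 0 a \<le> real n / t \<and> real n / t \<le> b"])
      fix n assume n: "max 0 a \<le> real n / t \<and> real n / t \<le> b"
      have "law.level n t - real n / t = (\<gamma> - real n / t) / (t + 1)"
        using elim(1) by (simp add: law.level_def field_simps)
      also have "\<bar>\<dots>\<bar> = \<bar>\<gamma> - real n / t\<bar> / (t + 1)"
        using elim(1) by (simp add: abs_divide)
      also have "\<dots> \<le> (\<gamma> + b) / (t + 1)"
        using elim(1) n assms(2) by (intro divide_right_mono) linarith+
      also have "\<dots> \<le> \<eta>"
      proof -
        have "\<gamma> + b \<le> t * \<eta>" using elim(2) \<eta>(1) by (simp only: pos_divide_le_eq)
        also have "\<dots> \<le> \<eta> * (t + 1)" using \<eta>(1) by (simp add: algebra_simps)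
        finally show ?thesis using elim(1) by (simp add: pos_divide_le_eq)
      qed
      finally show "(\<eta> * \<eta>)\<^sup>2 \<le> \<psi> (law.level n t)"
        using n \<eta> by (intro \<psi>_ge) linarith+
    next
      fix \<omega> assume "\<omega> \<in> {\<omega> \<in> space M. ereal_of_enat (N t \<omega>) / ereal t \<in> {ereal a..ereal b}}"
      then show "\<omega> \<in> space M \<and> (\<exists>n. N t \<omega> = enat n \<and> max 0 a \<le> real n / t \<and> real n / t \<le> b)"
        using ereal_of_enat_divide_in_interval[OF elim(1)] by blast
    next
      show "\<psi> x = 0" if "x \<ge> d" for x using that by (simp add: \<psi>_def)
    qed (use elim \<eta>(1) in \<open>auto simp: \<psi>_def\<close>)
  qed
  have "((\<lambda>t. law.mean \<psi> t / (\<eta> * \<eta>)\<^sup>2) \<longlongrightarrow> 0) at_top"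
    by (rule tendsto_divide_zero[OF lim])
  from tendsto_sandwich[OF _ le tendsto_const this] show ?thesis by simp
qed

end
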